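(* In classical propositional logic (in the two-sorted language described in the context), every formula $A$ is ${\sf par}$-projective. Moreover, for every formula $A$, the formula $\mathrm{U}(A)\to A$ is projective, where $\mathrm{U}(A)$ denotes the uniform post-interpolant of $A$ with respect to ${\sf par}$.
   Context: The language $\mathcal{L}$ is built from atoms ${\sf atom}={\sf var}\cup{\sf par}$, where ${\sf var}$ (variables) and ${\sf par}$ (parameters) are disjoint infinite sets, using $\bot,\wedge,\vee,\to$; $\top:=\bot\to\bot$, $\neg A:=A\to\bot$. $\mathcal{L}({\sf par})$ is the set of formulas containing only parameters as atoms. A substitution is a map $\theta:\mathcal{L}\to\mathcal{L}$ commuting with all connectives and with $\theta(p)=p$ for all $p\in{\sf par}$. $\vdash$ denotes classical derivability. $\theta$ is an $A$-identity if $A\vdash\theta(a)\leftrightarrow a$ for every atom $a$. For $E\in\mathcal{L}({\sf par})$, $\theta$ is an $E$-fier of $A$ if $\vdash\theta(A)\leftrightarrow E$. $A$ is $E$-projective if some $\theta$ is both an $A$-identity and an $E$-fier of $A$; $A$ is ${\sf par}$-projective if it is $E$-projective for some $E\in\mathcal{L}({\sf par})$; $A$ is projective if it is $\top$-projective (i.e. some $A$-identity $\theta$ has $\vdash\theta(A)$). The uniform post-interpolant $\mathrm{U}(A)$ of $A$ w.r.t. ${\sf par}$ is a formula $B\in\mathcal{L}({\sf par})$ with $\vdash A\to B$ and $\vdash B\to C$ for every $C\in\mathcal{L}({\sf par})$ with $\vdash A\to C$ (it exists in classical logic and is unique up to provable equivalence). *)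

theory Defs
  imports Main
begin

datatype ('v, 'p) atom = Var 'v | Par 'p

datatype (atoms: 'a) form =
    Atom 'a
  | Bot  (\<open>\<^bold>\<bottom>\<close>)
  | And "'a form" "'a form"  (infixr \<open>\<^bold>\<and>\<close> 68)
  | Or "'a form" "'a form"  (infixr \<open>\<^bold>\<or>\<close> 67)
  | Imp "'a form" "'a form"  (infixr \<open>\<^bold>\<rightarrow>\<close> 66)

abbreviation Neg :: "'a form \<Rightarrow> 'a form"  (\<open>\<^bold>\<not> _\<close> [70] 70) where
  "\<^bold>\<not> A \<equiv> A \<^bold>\<rightarrow> \<^bold>\<bottom>"

abbreviation Top :: "'a form"  (\<open>\<^bold>\<top>\<close>) where
  "\<^bold>\<top> \<equiv> \<^bold>\<bottom> \<^bold>\<rightarrow> \<^bold>\<bottom>"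

abbreviation Iff :: "'a form \<Rightarrow> 'a form \<Rightarrow> 'a form"  (infix \<open>\<^bold>\<leftrightarrow>\<close> 65) where
  "A \<^bold>\<leftrightarrow> B \<equiv> (A \<^bold>\<rightarrow> B) \<^bold>\<and> (B \<^bold>\<rightarrow> A)"

type_synonym ('v, 'p) fm = "('v, 'p) atom form"

definition Lpar :: "('v, 'p) fm set" where
  "Lpar = {A. atoms A \<subseteq> range Par}"

text \<open>Classical derivability: natural deduction, with sets of open assumptions. The rule
  \<open>RAA\<close> makes the calculus classical and subsumes ex falso.\<close>

inductive deriv :: "'a form set \<Rightarrow> 'a form \<Rightarrow> bool"  (infix \<open>\<turnstile>\<close> 50) where
  Assm: "A \<in> \<Gamma> \<Longrightarrow> \<Gamma> \<turnstile> A"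
| RAA: "insert (\<^bold>\<not> A) \<Gamma> \<turnstile> \<^bold>\<bottom> \<Longrightarrow> \<Gamma> \<turnstile> A"
| AndI: "\<Gamma> \<turnstile> A \<Longrightarrow> \<Gamma> \<turnstile> B \<Longrightarrow> \<Gamma> \<turnstile> A \<^bold>\<and> B"
| AndE1: "\<Gamma> \<turnstile> A \<^bold>\<and> B \<Longrightarrow> \<Gamma> \<turnstile> A"
| AndE2: "\<Gamma> \<turnstile> A \<^bold>\<and> B \<Longrightarrow> \<Gamma> \<turnstile> B"
| OrI1: "\<Gamma> \<turnstile> A \<Longrightarrow> \<Gamma> \<turnstile> A \<^bold>\<or> B"
| OrI2: "\<Gamma> \<turnstile> B \<Longrightarrow> \<Gamma> \<turnstile> A \<^bold>\<or> B"
| OrE: "\<Gamma> \<turnstile> A \<^bold>\<or> B \<Longrightarrow> insert A \<Gamma> \<turnstile> C \<Longrightarrow> insert B \<Gamma> \<turnstile> C \<Longrightarrow> \<Gamma> \<turnstile> C"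
| ImpI: "insert A \<Gamma> \<turnstile> B \<Longrightarrow> \<Gamma> \<turnstile> A \<^bold>\<rightarrow> B"
| ImpE: "\<Gamma> \<turnstile> A \<^bold>\<rightarrow> B \<Longrightarrow> \<Gamma> \<turnstile> A \<Longrightarrow> \<Gamma> \<turnstile> B"

definition substitution :: "(('v, 'p) fm \<Rightarrow> ('v, 'p) fm) \<Rightarrow> bool" where
  "substitution \<theta> \<longleftrightarrow>
     \<theta> \<^bold>\<bottom> = \<^bold>\<bottom> \<and>
     (\<forall>A B. \<theta> (A \<^bold>\<and> B) = \<theta> A \<^bold>\<and> \<theta> B) \<and>
     (\<forall>A B. \<theta> (A \<^bold>\<or> B) = \<theta> A \<^bold>\<or> \<theta> B) \<and>
     (\<forall>A B. \<theta> (A \<^bold>\<rightarrow> B) = \<theta> A \<^bold>\<rightarrow> \<theta> B) \<and>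
     (\<forall>p. \<theta> (Atom (Par p)) = Atom (Par p))"

definition identity_for :: "('v, 'p) fm \<Rightarrow> (('v, 'p) fm \<Rightarrow> ('v, 'p) fm) \<Rightarrow> bool" where
  "identity_for A \<theta> \<longleftrightarrow> (\<forall>a. {A} \<turnstile> \<theta> (Atom a) \<^bold>\<leftrightarrow> Atom a)"

definition fier :: "('v, 'p) fm \<Rightarrow> ('v, 'p) fm \<Rightarrow> (('v, 'p) fm \<Rightarrow> ('v, 'p) fm) \<Rightarrow> bool" where
  "fier E A \<theta> \<longleftrightarrow> {} \<turnstile> \<theta> A \<^bold>\<leftrightarrow> E"

definition E_projective :: "('v, 'p) fm \<Rightarrow> ('v, 'p) fm \<Rightarrow> bool" where
  "E_projective E A \<longleftrightarrow> (\<exists>\<theta>. substitution \<theta> \<and> identity_for A \<theta> \<and> fier E A \<theta>)"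

definition par_projective :: "('v, 'p) fm \<Rightarrow> bool" where
  "par_projective A \<longleftrightarrow> (\<exists>E \<in> Lpar. E_projective E A)"

definition projective :: "('v, 'p) fm \<Rightarrow> bool" where
  "projective A \<longleftrightarrow> E_projective \<^bold>\<top> A"

text \<open>\<open>is_U A B\<close>: the formula \<open>B\<close> is a uniform post-interpolant \<open>U(A)\<close> with respect to the
  parameters. Since \<open>U(A)\<close> is determined only up to provable equivalence, it is a relation; see
  \<open>is_U_exists\<close> and \<open>is_U_unique\<close> below.\<close>

definition is_U :: "('v, 'p) fm \<Rightarrow> ('v, 'p) fm \<Rightarrow> bool" where
  "is_U A B \<longleftrightarrow> B \<in> Lpar \<and> {} \<turnstile> A \<^bold>\<rightarrow> B \<and> (\<forall>C \<in> Lpar. {} \<turnstile> A \<^bold>\<rightarrow> C \<longrightarrow> {} \<turnstile> B \<^bold>\<rightarrow> C)"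

lemma is_U_unique: "is_U A B \<Longrightarrow> is_U A B' \<Longrightarrow> {} \<turnstile> B \<^bold>\<leftrightarrow> B'"
  by (simp add: is_U_def AndI)

lemma weaken: "\<Gamma> \<turnstile> A \<Longrightarrow> \<Gamma> \<subseteq> \<Delta> \<Longrightarrow> \<Delta> \<turnstile> A"
proof (induction arbitrary: \<Delta> rule: deriv.induct)
  case (OrE \<Gamma> A B C)
  show ?case by (rule deriv.OrE[of _ A B]) (simp_all add: OrE subset_insertI2)
next
  case (Assm A \<Gamma>)
  then show ?case by (blast intro: deriv.Assm)
next
  case (RAA A \<Gamma>)
  show ?case by (rule deriv.RAA) (simp add: RAA subset_insertI2)
next
  case (ImpI A \<Gamma> B)
  show ?case by (rule deriv.ImpI) (simp add: ImpI subset_insertI2)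
next
  case (AndE1 \<Gamma> A B)
  show ?case by (rule deriv.AndE1[of _ _ B]) (simp add: AndE1)
next
  case (AndE2 \<Gamma> A B)
  show ?case by (rule deriv.AndE2[of _ A]) (simp add: AndE2)
next
  case (ImpE \<Gamma> A B)
  show ?case by (rule deriv.ImpE[of _ A]) (simp_all add: ImpE)
qed (simp_all add: AndI OrI1 OrI2)

primrec bind :: "('a \<Rightarrow> 'b form) \<Rightarrow> 'a form \<Rightarrow> 'b form" where
  "bind \<sigma> (Atom a) = \<sigma> a"
| "bind \<sigma> \<^bold>\<bottom> = \<^bold>\<bottom>"
| "bind \<sigma> (A \<^bold>\<and> B) = bind \<sigma> A \<^bold>\<and> bind \<sigma> B"
| "bind \<sigma> (A \<^bold>\<or> B) = bind \<sigma> A \<^bold>\<or> bind \<sigma> B"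
| "bind \<sigma> (A \<^bold>\<rightarrow> B) = bind \<sigma> A \<^bold>\<rightarrow> bind \<sigma> B"

lemma deriv_bind: "\<Gamma> \<turnstile> A \<Longrightarrow> bind \<sigma> ` \<Gamma> \<turnstile> bind \<sigma> A"
proof (induction rule: deriv.induct)
  case (OrE \<Gamma> A B C)
  then show ?case using deriv.OrE[of "bind \<sigma> ` \<Gamma>" "bind \<sigma> A" "bind \<sigma> B" "bind \<sigma> C"] by simp
next
  case (RAA A \<Gamma>)
  then show ?case using deriv.RAA[of "bind \<sigma> A" "bind \<sigma> ` \<Gamma>"] by simp
next
  case (AndE1 \<Gamma> A B)
  then show ?case using deriv.AndE1[of "bind \<sigma> ` \<Gamma>" "bind \<sigma> A" "bind \<sigma> B"] by simp
next
  case (AndE2 \<Gamma> A B)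
  then show ?case using deriv.AndE2[of "bind \<sigma> ` \<Gamma>" "bind \<sigma> A" "bind \<sigma> B"] by simp
next
  case (ImpE \<Gamma> A B)
  then show ?case using deriv.ImpE[of "bind \<sigma> ` \<Gamma>" "bind \<sigma> A" "bind \<sigma> B"] by simp
qed (simp_all add: Assm AndI OrI1 OrI2 ImpI)

lemma atoms_bind: "atoms (bind \<sigma> A) = (\<Union>a \<in> atoms A. atoms (\<sigma> a))"
  by (induction A) auto

lemma bind_id: "(\<And>a. a \<in> atoms A \<Longrightarrow> \<sigma> a = Atom a) \<Longrightarrow> bind \<sigma> A = A"
  by (induction A) auto

lemma finite_atoms: "finite (atoms A)"
  by (induction A) auto

lemma imp_trans: "\<Gamma> \<turnstile> A \<^bold>\<rightarrow> B \<Longrightarrow> \<Gamma> \<turnstile> B \<^bold>\<rightarrow> C \<Longrightarrow> \<Gamma> \<turnstile> A \<^bold>\<rightarrow> C"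
  by (rule ImpI, rule ImpE[of _ B], erule weaken[OF _ subset_insertI],
      rule ImpE[of _ A], erule weaken[OF _ subset_insertI], rule Assm, simp)

lemma imp_detach: "\<Gamma> \<turnstile> A \<^bold>\<rightarrow> B \<Longrightarrow> insert A \<Gamma> \<turnstile> B"
  by (rule ImpE[of _ A], erule weaken[OF _ subset_insertI], rule Assm, simp)

lemma replacement:
  assumes "\<And>a. \<Gamma> \<turnstile> Atom a \<^bold>\<leftrightarrow> \<sigma> a"
  shows "\<Gamma> \<turnstile> A \<^bold>\<rightarrow> bind \<sigma> A \<and> \<Gamma> \<turnstile> bind \<sigma> A \<^bold>\<rightarrow> A"
proof (induction A)
  case (Atom a)
  then show ?case using AndE1[OF assms[of a]] AndE2[OF assms[of a]] by simp
next
  case Bot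
  then show ?case by (simp add: ImpI Assm)
next
  have conj: "\<Gamma> \<turnstile> A \<^bold>\<and> B \<^bold>\<rightarrow> A' \<^bold>\<and> B'" if "\<Gamma> \<turnstile> A \<^bold>\<rightarrow> A'" "\<Gamma> \<turnstile> B \<^bold>\<rightarrow> B'" for A A' B B'
  proof (rule ImpI)
    let ?\<Gamma> = "insert (A \<^bold>\<and> B) \<Gamma>"
    have AB: "?\<Gamma> \<turnstile> A \<^bold>\<and> B" by (simp add: Assm)
    have "?\<Gamma> \<turnstile> A \<^bold>\<rightarrow> A'" "?\<Gamma> \<turnstile> B \<^bold>\<rightarrow> B'"
      using that by (simp_all add: weaken[OF _ subset_insertI])
    with AB show "?\<Gamma> \<turnstile> A' \<^bold>\<and> B'" by (meson AndE1 AndE2 AndI ImpE)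
  qed
  case (And A B)
  then show ?case by (simp add: conj)
next
  have disj: "\<Gamma> \<turnstile> A \<^bold>\<or> B \<^bold>\<rightarrow> A' \<^bold>\<or> B'" if "\<Gamma> \<turnstile> A \<^bold>\<rightarrow> A'" "\<Gamma> \<turnstile> B \<^bold>\<rightarrow> B'" for A A' B B'
  proof (rule ImpI, rule OrE[of _ A B])
    let ?\<Gamma> = "insert (A \<^bold>\<or> B) \<Gamma>"
    show "?\<Gamma> \<turnstile> A \<^bold>\<or> B" by (simp add: Assm)
    show "insert A ?\<Gamma> \<turnstile> A' \<^bold>\<or> B'"
      by (rule OrI1, rule weaken[OF imp_detach[OF that(1)]]) blast
    show "insert B ?\<Gamma> \<turnstile> A' \<^bold>\<or> B'"
      by (rule OrI2, rule weaken[OF imp_detach[OF that(2)]]) blast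
  qed
  case (Or A B)
  then show ?case by (simp add: disj)
next
  have imp: "\<Gamma> \<turnstile> (A \<^bold>\<rightarrow> B) \<^bold>\<rightarrow> (A' \<^bold>\<rightarrow> B')" if "\<Gamma> \<turnstile> A' \<^bold>\<rightarrow> A" "\<Gamma> \<turnstile> B \<^bold>\<rightarrow> B'" for A A' B B'
  proof (rule ImpI)
    let ?\<Gamma> = "insert (A \<^bold>\<rightarrow> B) \<Gamma>"
    have "?\<Gamma> \<turnstile> A' \<^bold>\<rightarrow> A" "?\<Gamma> \<turnstile> B \<^bold>\<rightarrow> B'"
      using that by (simp_all add: weaken[OF _ subset_insertI])
    moreover have "?\<Gamma> \<turnstile> A \<^bold>\<rightarrow> B" by (simp add: Assm)
    ultimately show "?\<Gamma> \<turnstile> A' \<^bold>\<rightarrow> B'" by (meson imp_trans)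
  qed
  case (Imp A B)
  then show ?case by (simp add: imp)
qed

lemma excluded_middle: "\<Gamma> \<turnstile> A \<^bold>\<or> \<^bold>\<not> A"
proof (rule RAA)
  let ?\<Gamma> = "insert (\<^bold>\<not> (A \<^bold>\<or> \<^bold>\<not> A)) \<Gamma>"
  have "insert A ?\<Gamma> \<turnstile> \<^bold>\<bottom>"
    by (rule ImpE[of _ "A \<^bold>\<or> \<^bold>\<not> A"]) (auto intro: Assm OrI1)
  then have "?\<Gamma> \<turnstile> A \<^bold>\<or> \<^bold>\<not> A" by (intro OrI2 ImpI)
  then show "?\<Gamma> \<turnstile> \<^bold>\<bottom>" by (rule ImpE[OF Assm, rotated]) simp
qed

lemma eliminate_atom:
  fixes A :: "'a form"
  defines "S \<equiv> \<lambda>x F. bind (Atom(x := F))"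
  shows "{} \<turnstile> A \<^bold>\<rightarrow> S x \<^bold>\<top> A \<^bold>\<or> S x \<^bold>\<bottom> A"
proof (rule ImpI, rule OrE[OF excluded_middle[of _ "Atom x"]])
  have refl: "\<Gamma> \<turnstile> F \<^bold>\<rightarrow> F" for \<Gamma> and F :: "'a form" by (simp add: Assm ImpI)
  let ?P = "{Atom x, A}" and ?N = "{\<^bold>\<not> Atom x, A}"
  have "?P \<turnstile> Atom a \<^bold>\<leftrightarrow> (Atom(x := \<^bold>\<top>)) a" for a
    by (cases "a = x") (simp_all add: AndI ImpI refl Assm)
  then have "?P \<turnstile> S x \<^bold>\<top> A"
    using replacement[of ?P "Atom(x := \<^bold>\<top>)" A] by (simp add: S_def) (meson Assm ImpE insertCI)
  then show "?P \<turnstile> S x \<^bold>\<top> A \<^bold>\<or> S x \<^bold>\<bottom> A" by (rule OrI1)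
  have "?N \<turnstile> \<^bold>\<bottom> \<^bold>\<rightarrow> Atom x" by (rule ImpI, rule RAA, rule Assm) simp
  then have "?N \<turnstile> Atom a \<^bold>\<leftrightarrow> (Atom(x := \<^bold>\<bottom>)) a" for a
    by (cases "a = x") (simp_all add: AndI refl Assm)
  then have "?N \<turnstile> S x \<^bold>\<bottom> A"
    using replacement[of ?N "Atom(x := \<^bold>\<bottom>)" A] by (simp add: S_def) (meson Assm ImpE insertCI)
  then show "?N \<turnstile> S x \<^bold>\<top> A \<^bold>\<or> S x \<^bold>\<bottom> A" by (rule OrI2)
qed

lemma eliminate_atoms:
  assumes "finite X"
  shows "\<exists>B. atoms B \<subseteq> atoms A - X \<and> {} \<turnstile> A \<^bold>\<rightarrow> B \<and>
    (\<forall>C. atoms C \<inter> X = {} \<longrightarrow> {} \<turnstile> A \<^bold>\<rightarrow> C \<longrightarrow> {} \<turnstile> B \<^bold>\<rightarrow> C)"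
  using assms
proof (induction X)
  case empty
  have "{} \<turnstile> A \<^bold>\<rightarrow> A" by (simp add: Assm ImpI)
  then show ?case by auto
next
  case (insert x X)
  then obtain B where B: "atoms B \<subseteq> atoms A - X" "{} \<turnstile> A \<^bold>\<rightarrow> B"
    "\<And>C. atoms C \<inter> X = {} \<Longrightarrow> {} \<turnstile> A \<^bold>\<rightarrow> C \<Longrightarrow> {} \<turnstile> B \<^bold>\<rightarrow> C" by blast
  let ?S = "\<lambda>F. bind (Atom(x := F)) B"
  let ?B = "?S \<^bold>\<top> \<^bold>\<or> ?S \<^bold>\<bottom>"
  have "atoms ?B \<subseteq> atoms A - insert x X"
    using B(1) by (auto simp: atoms_bind split: if_splits)
  moreover have "{} \<turnstile> A \<^bold>\<rightarrow> ?B"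
    using imp_trans[OF B(2) eliminate_atom] .
  moreover have "{} \<turnstile> ?B \<^bold>\<rightarrow> C" if C: "atoms C \<inter> insert x X = {}" "{} \<turnstile> A \<^bold>\<rightarrow> C" for C
  proof -
    have "{} \<turnstile> B \<^bold>\<rightarrow> C" using B(3) C by blast
    moreover have "bind (Atom(x := F)) C = C" for F using C(1) by (intro bind_id) auto
    ultimately have "{} \<turnstile> ?S F \<^bold>\<rightarrow> C" for F
      using deriv_bind[of "{}" "B \<^bold>\<rightarrow> C" "Atom(x := F)"] by simp
    then have "insert (?S F) {?B} \<turnstile> C" for F
      using imp_detach by (meson bot.extremum insert_mono weaken)
    then show ?thesis by - (rule ImpI, rule OrE[OF Assm], simp_all)
  qed
  ultimately show ?case by blast
qed

lemma is_U_exists: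
  fixes A :: "('v, 'p) fm"
  shows "\<exists>B. is_U A B"
proof -
  have "finite (atoms A - range Par)" by (simp add: finite_atoms)
  from eliminate_atoms[OF this, of A] obtain B where
    B: "atoms B \<subseteq> atoms A - (atoms A - range Par)" "{} \<turnstile> A \<^bold>\<rightarrow> B"
    "\<And>C. atoms C \<inter> (atoms A - range Par) = {} \<Longrightarrow> {} \<turnstile> A \<^bold>\<rightarrow> C \<Longrightarrow> {} \<turnstile> B \<^bold>\<rightarrow> C"
    by auto
  have "{} \<turnstile> B \<^bold>\<rightarrow> C" if "C \<in> Lpar" "{} \<turnstile> A \<^bold>\<rightarrow> C" for C
    using B(3) that unfolding Lpar_def by auto
  moreover have "B \<in> Lpar" using B(1) unfolding Lpar_def by auto
  ultimately show ?thesis using B(2) unfolding is_U_def by auto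
qed

end

theory Submission
  imports Defs
begin

text \<open>A variable \<open>x\<close> is eliminated by sending it to \<open>F = A \<and> x \<or> \<not>A \<and> A[\<top>/x]\<close>: under \<open>A\<close> this is
  \<open>x\<close> itself, and otherwise it is a value of \<open>x\<close> making \<open>A\<close> true whenever there is one, so that
  \<open>A[F/x]\<close> is equivalent to \<open>A[\<top>/x] \<or> A[\<bottom>/x]\<close>. Eliminating all variables of \<open>A\<close> in turn and
  composing the substitutions gives an \<open>A\<close>-identity turning \<open>A\<close> into a formula \<open>E\<close> in the
  parameters. Any such \<open>E\<close> follows from \<open>A\<close>; for \<open>U(A) \<rightarrow> A\<close> in place of \<open>A\<close>, it follows both from
  \<open>\<not>U(A)\<close> and from \<open>A\<close>, hence also from \<open>U(A)\<close>, so it is provable.\<close>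

lemma cut: "\<Gamma> \<turnstile> B \<Longrightarrow> insert B \<Gamma> \<turnstile> C \<Longrightarrow> \<Gamma> \<turnstile> C"
  by (rule ImpE[OF ImpI])

lemma deriv_cases: "insert B \<Gamma> \<turnstile> C \<Longrightarrow> insert (\<^bold>\<not> B) \<Gamma> \<turnstile> C \<Longrightarrow> \<Gamma> \<turnstile> C"
  by (rule OrE[OF excluded_middle])

lemma deriv_refl: "\<Gamma> \<turnstile> A \<^bold>\<rightarrow> A"
  by (simp add: Assm ImpI)

lemma ex_falso: "\<Gamma> \<turnstile> \<^bold>\<bottom> \<Longrightarrow> \<Gamma> \<turnstile> A"
  by (rule RAA, erule weaken) blast

lemma contradiction: "\<Gamma> \<turnstile> A \<Longrightarrow> \<Gamma> \<turnstile> \<^bold>\<not> A \<Longrightarrow> \<Gamma> \<turnstile> B"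
  by (rule ex_falso[OF ImpE])

lemma iff_sym: "\<Gamma> \<turnstile> A \<^bold>\<leftrightarrow> B \<Longrightarrow> \<Gamma> \<turnstile> B \<^bold>\<leftrightarrow> A"
  by (rule AndI[OF AndE2 AndE1])

lemma iff_trans: "\<Gamma> \<turnstile> A \<^bold>\<leftrightarrow> B \<Longrightarrow> \<Gamma> \<turnstile> B \<^bold>\<leftrightarrow> C \<Longrightarrow> \<Gamma> \<turnstile> A \<^bold>\<leftrightarrow> C"
  by (meson AndI AndE1 AndE2 imp_trans)

lemma bind_iff:
  assumes "\<And>a. \<Gamma> \<turnstile> \<sigma> a \<^bold>\<leftrightarrow> Atom a"
  shows "\<Gamma> \<turnstile> bind \<sigma> A \<^bold>\<leftrightarrow> A"
  using replacement[of \<Gamma> \<sigma> A] iff_sym[OF assms] by (simp add: AndI)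

lemma bind_bind: "bind \<tau> (bind \<sigma> A) = bind (\<lambda>a. bind \<tau> (\<sigma> a)) A"
  by (induction A) auto

lemma bind_absent: "x \<notin> atoms A \<Longrightarrow> bind (Atom(x := F)) A = A"
  by (rule bind_id) auto

text \<open>Where \<open>x\<close> and \<open>K\<close> agree, \<open>A\<close> is equivalent to
  \<open>A[K/x]\<close>. Substituting \<open>F\<close> for \<open>x\<close> throughout that
  derivation gives the claim, because \<open>x\<close> is already gone from
  \<open>A[K/x]\<close>.\<close>

lemma instance_iff:
  assumes "x \<notin> atoms K" and "\<Gamma> \<turnstile> Atom x \<^bold>\<leftrightarrow> K"
  shows "bind (Atom(x := F)) ` \<Gamma> \<turnstile> bind (Atom(x := F)) A \<^bold>\<leftrightarrow> bind (Atom(x := K)) A"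
proof -
  have "\<Gamma> \<turnstile> (Atom(x := K)) a \<^bold>\<leftrightarrow> Atom a" for a
    using assms(2) by (cases "a = x") (simp_all add: iff_sym AndI deriv_refl)
  from deriv_bind[OF iff_sym[OF bind_iff[OF this, of A]], of "Atom(x := F)"]
  have "bind (Atom(x := F)) ` \<Gamma> \<turnstile>
      bind (Atom(x := F)) A \<^bold>\<leftrightarrow> bind (Atom(x := F)) (bind (Atom(x := K)) A)"
    by (simp del: fun_upd_apply)
  moreover have "x \<notin> atoms (bind (Atom(x := K)) A)"
    using assms(1) by (auto simp: atoms_bind split: if_splits)
  note bind_absent[OF this, of F]
  ultimately show ?thesis by (simp only:)
qed

text \<open>The context \<open>{Atom x}\<close> equates \<open>x\<close> with \<top>, and
  substituting \<open>F\<close> for \<open>x\<close> turns this context into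
  \<open>{F}\<close>.\<close>

lemma instance_true: "{F} \<turnstile> bind (Atom(x := F)) A \<^bold>\<leftrightarrow> bind (Atom(x := \<^bold>\<top>)) A"
  using instance_iff[of x "\<^bold>\<top>" "{Atom x}" F A] by (simp add: AndI ImpI deriv_refl Assm)

lemma instance_false: "{\<^bold>\<not> F} \<turnstile> bind (Atom(x := F)) A \<^bold>\<leftrightarrow> bind (Atom(x := \<^bold>\<bottom>)) A"
proof -
  have "{\<^bold>\<not> Atom x} \<turnstile> Atom x \<^bold>\<leftrightarrow> \<^bold>\<bottom>"
    by (rule AndI[OF Assm ImpI[OF ex_falso[OF Assm]]]) simp_all
  from instance_iff[OF _ this, of F A] show ?thesis by simp
qed

lemma eliminating_substitution:
  fixes A :: "'a form"
  obtains F where "{A} \<turnstile> F \<^bold>\<leftrightarrow> Atom x"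
    and "{} \<turnstile> bind (Atom(x := F)) A \<^bold>\<leftrightarrow> bind (Atom(x := \<^bold>\<top>)) A \<^bold>\<or> bind (Atom(x := \<^bold>\<bottom>)) A"
proof
  let ?G = "bind (Atom(x := \<^bold>\<top>)) A" and ?H = "bind (Atom(x := \<^bold>\<bottom>)) A"
  let ?F = "A \<^bold>\<and> Atom x \<^bold>\<or> \<^bold>\<not> A \<^bold>\<and> ?G"
  let ?S = "bind (Atom(x := ?F)) A"
  show id: "{A} \<turnstile> ?F \<^bold>\<leftrightarrow> Atom x"
  proof (rule AndI; rule ImpI)
    show "{?F, A} \<turnstile> Atom x"
    proof (rule OrE)
      show "{?F, A} \<turnstile> ?F" by (simp add: Assm)
      show "insert (A \<^bold>\<and> Atom x) {?F, A} \<turnstile> Atom x" by (rule AndE2[OF Assm]) blast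
      have "insert (\<^bold>\<not> A \<^bold>\<and> ?G) {?F, A} \<turnstile> \<^bold>\<not> A" by (rule AndE1[OF Assm]) blast
      then show "insert (\<^bold>\<not> A \<^bold>\<and> ?G) {?F, A} \<turnstile> Atom x"
        by (rule contradiction[rotated]) (simp add: Assm)
    qed
    show "{Atom x, A} \<turnstile> ?F" by (intro OrI1 AndI Assm) simp_all
  qed
  have "{A} \<turnstile> (Atom(x := ?F)) a \<^bold>\<leftrightarrow> Atom a" for a
    using id by (cases "a = x") (simp_all add: AndI deriv_refl)
  \<comment> \<open>Under \<open>A\<close> the substitution moves no atom up to equivalence, so
    \<open>?S\<close> inherits the truth of \<open>A\<close>.\<close>
  then have "{A} \<turnstile> ?S \<^bold>\<leftrightarrow> A" by (rule bind_iff)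
  then have in_A: "\<Gamma> \<turnstile> ?S" if "A \<in> \<Gamma>" for \<Gamma>
    by (rule weaken[OF ImpE[OF AndE2 Assm[of A]]]) (use that in simp_all)
  \<comment> \<open>Once the truth value of \<open>?F\<close> is settled, \<open>?S\<close> reduces
    to the instance of \<open>A\<close> at that value: \<open>?G\<close> here, \<open>?H\<close> in
    the next fact.\<close>
  have in_F: "\<Gamma> \<turnstile> ?S" if "\<Gamma> \<turnstile> ?F" "\<Gamma> \<turnstile> ?G" for \<Gamma>
    by (rule cut[OF that(1)], rule ImpE[of _ ?G],
        rule weaken[OF AndE2[OF instance_true]], simp, rule weaken[OF that(2)], blast)
  have in_not_F: "\<Gamma> \<turnstile> ?S" if "\<Gamma> \<turnstile> \<^bold>\<not> ?F" "\<Gamma> \<turnstile> ?H" for \<Gamma>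
    by (rule cut[OF that(1)], rule ImpE[of _ ?H],
        rule weaken[OF AndE2[OF instance_false]], simp, rule weaken[OF that(2)], blast)
  \<comment> \<open>If \<open>A\<close> fails, \<open>?G\<close> supplies the second disjunct of
    \<open>?F\<close>, so \<open>x\<close> is sent to something true.\<close>
  have G: "insert ?G \<Gamma> \<turnstile> ?S" for \<Gamma>
  proof (rule deriv_cases)
    show "insert A (insert ?G \<Gamma>) \<turnstile> ?S" by (simp add: in_A)
    show "insert (\<^bold>\<not> A) (insert ?G \<Gamma>) \<turnstile> ?S"
      by (rule in_F; intro OrI2 AndI Assm) simp_all
  qed
  \<comment> \<open>The split is now on \<open>?F\<close>: if it fails, \<open>?S\<close> reduces to
    \<open>?H\<close>; if it holds, its disjuncts yield \<open>A\<close> or \<open>?G\<close>, both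
    settled above.\<close>
  have H: "insert ?H \<Gamma> \<turnstile> ?S" for \<Gamma>
  proof (rule deriv_cases)
    show "insert ?F (insert ?H \<Gamma>) \<turnstile> ?S"
    proof (rule OrE)
      show "insert ?F (insert ?H \<Gamma>) \<turnstile> ?F" by (simp add: Assm)
      show "insert (A \<^bold>\<and> Atom x) (insert ?F (insert ?H \<Gamma>)) \<turnstile> ?S"
        by (rule cut[OF AndE1[OF Assm]]) (auto intro: in_A)
      show "insert (\<^bold>\<not> A \<^bold>\<and> ?G) (insert ?F (insert ?H \<Gamma>)) \<turnstile> ?S"
        by (rule cut[OF AndE2[OF Assm] G]) blast
    qed
    show "insert (\<^bold>\<not> ?F) (insert ?H \<Gamma>) \<turnstile> ?S"
      by (rule in_not_F; rule Assm) simp_all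
  qed
  show "{} \<turnstile> ?S \<^bold>\<leftrightarrow> ?G \<^bold>\<or> ?H"
  proof (rule AndI)
    \<comment> \<open>Neither \<open>?G\<close> nor \<open>?H\<close> contains \<open>x\<close>, so
      putting \<open>?F\<close> for \<open>x\<close> in \<open>eliminate_atom\<close> changes only
      its premise, from \<open>A\<close> to \<open>?S\<close>.\<close>
    have "x \<notin> atoms ?G" "x \<notin> atoms ?H" by (auto simp: atoms_bind split: if_splits)
    then show "{} \<turnstile> ?S \<^bold>\<rightarrow> ?G \<^bold>\<or> ?H"
      using deriv_bind[OF eliminate_atom[of A x], of "Atom(x := ?F)"]
      by (simp add: bind_absent del: fun_upd_apply)
    show "{} \<turnstile> ?G \<^bold>\<or> ?H \<^bold>\<rightarrow> ?S"
      by (rule ImpI, rule OrE[OF Assm G H]) simp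
  qed
qed

text \<open>Induction on \<open>X\<close> with \<open>A\<close> generalized: after \<open>x\<close>
  is eliminated, the hypothesis is applied to the disjunction of the two instances of
  \<open>A\<close>.\<close>

lemma eliminating_substitutions:
  assumes "finite X"
  shows "\<exists>\<sigma> E. atoms E \<subseteq> atoms A - X \<and> (\<forall>a. a \<notin> X \<longrightarrow> \<sigma> a = Atom a) \<and>
    (\<forall>a. {A} \<turnstile> \<sigma> a \<^bold>\<leftrightarrow> Atom a) \<and> {} \<turnstile> bind \<sigma> A \<^bold>\<leftrightarrow> E"
  using assms
proof (induction X arbitrary: A)
  case empty
  have "{} \<turnstile> bind Atom A \<^bold>\<leftrightarrow> A" by (simp add: bind_id AndI deriv_refl)
  then show ?case by (intro exI[of _ Atom] exI[of _ A]) (simp add: AndI deriv_refl)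
next
  case (insert x X)
  obtain F where F: "{A} \<turnstile> F \<^bold>\<leftrightarrow> Atom x"
    "{} \<turnstile> bind (Atom(x := F)) A \<^bold>\<leftrightarrow> bind (Atom(x := \<^bold>\<top>)) A \<^bold>\<or> bind (Atom(x := \<^bold>\<bottom>)) A"
    by (rule eliminating_substitution)
  define \<sigma> where "\<sigma> = Atom(x := F)"
  define B where "B = bind (Atom(x := \<^bold>\<top>)) A \<^bold>\<or> bind (Atom(x := \<^bold>\<bottom>)) A"
  obtain \<tau> E where \<tau>: "atoms E \<subseteq> atoms B - X" "\<And>a. a \<notin> X \<Longrightarrow> \<tau> a = Atom a"
    "\<And>a. {B} \<turnstile> \<tau> a \<^bold>\<leftrightarrow> Atom a" "{} \<turnstile> bind \<tau> B \<^bold>\<leftrightarrow> E"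
    using insert.IH[of B] by blast
  \<comment> \<open>The substitution for \<open>x\<close> acts first; \<open>\<tau>\<close> then
    removes the atoms of \<open>X\<close> from its result.\<close>
  let ?\<rho> = "\<lambda>a. bind \<tau> (\<sigma> a)"
  have "atoms E \<subseteq> atoms A - insert x X"
    using \<tau>(1) by (auto simp: B_def atoms_bind split: if_splits)
  moreover have "?\<rho> a = Atom a" if "a \<notin> insert x X" for a
    using that \<tau>(2) by (simp add: \<sigma>_def)
  moreover have "{A} \<turnstile> ?\<rho> a \<^bold>\<leftrightarrow> Atom a" for a
  proof (rule iff_trans)
    \<comment> \<open>Since \<open>A\<close> entails \<open>B\<close>, the \<open>B\<close>-identity
      \<open>\<tau>\<close> is also an \<open>A\<close>-identity.\<close>
    have "{A} \<turnstile> B" unfolding B_def by (rule imp_detach[OF eliminate_atom])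
    then have "{A} \<turnstile> \<tau> b \<^bold>\<leftrightarrow> Atom b" for b
      by (rule cut) (rule weaken[OF \<tau>(3)], blast)
    then show "{A} \<turnstile> ?\<rho> a \<^bold>\<leftrightarrow> \<sigma> a" by (rule bind_iff)
    show "{A} \<turnstile> \<sigma> a \<^bold>\<leftrightarrow> Atom a"
      using F(1) by (simp add: \<sigma>_def AndI deriv_refl)
  qed
  moreover have "{} \<turnstile> bind ?\<rho> A \<^bold>\<leftrightarrow> E"
  proof (rule iff_trans[OF _ \<tau>(4)])
    show "{} \<turnstile> bind ?\<rho> A \<^bold>\<leftrightarrow> bind \<tau> B"
      using deriv_bind[OF F(2), of \<tau>] by (simp add: bind_bind B_def \<sigma>_def del: fun_upd_apply)
  qed
  ultimately show ?case by (intro exI[of _ ?\<rho>] exI[of _ E]) simp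
qed

lemma par_projective_all: "par_projective (A :: ('v, 'p) fm)"
proof -
  \<comment> \<open>Eliminating only the non-parameters of \<open>A\<close> keeps the set finite and
    leaves every parameter fixed, as \<open>substitution\<close> demands.\<close>
  have "finite (atoms A - range Par)" by (simp add: finite_atoms)
  from eliminating_substitutions[OF this, of A] obtain \<sigma> E where
    \<sigma>: "atoms E \<subseteq> atoms A - (atoms A - range Par)"
      "\<And>a. a \<notin> atoms A - range Par \<Longrightarrow> \<sigma> a = Atom a"
      "\<And>a. {A} \<turnstile> \<sigma> a \<^bold>\<leftrightarrow> Atom a" "{} \<turnstile> bind \<sigma> A \<^bold>\<leftrightarrow> E"
    by blast
  have "substitution (bind \<sigma>)" using \<sigma>(2) by (simp add: substitution_def)
  then have "E_projective E A"
    using \<sigma>(3,4) unfolding E_projective_def identity_for_def fier_def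
    by (intro exI[of _ "bind \<sigma>"]) simp
  moreover have "E \<in> Lpar" using \<sigma>(1) by (auto simp: Lpar_def)
  ultimately show ?thesis by (auto simp: par_projective_def)
qed

lemma substitution_eq_bind: "substitution \<theta> \<Longrightarrow> \<theta> A = bind (\<lambda>a. \<theta> (Atom a)) A"
  by (induction A) (simp_all add: substitution_def)

text \<open>An \<open>A\<close>-identity fixes \<open>A\<close> itself up to equivalence under
  \<open>A\<close>, while its value at \<open>A\<close> is equivalent to \<open>E\<close>
  outright.\<close>

lemma E_projective_imp:
  assumes "E_projective E A"
  shows "{} \<turnstile> A \<^bold>\<rightarrow> E"
proof -
  obtain \<theta> where \<theta>: "substitution \<theta>" "\<And>a. {A} \<turnstile> \<theta> (Atom a) \<^bold>\<leftrightarrow> Atom a" "{} \<turnstile> \<theta> A \<^bold>\<leftrightarrow> E"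
    using assms unfolding E_projective_def identity_for_def fier_def by blast
  have "{A} \<turnstile> \<theta> A \<^bold>\<leftrightarrow> A"
    using bind_iff[OF \<theta>(2), where A = A] substitution_eq_bind[OF \<theta>(1), of A] by simp
  then have "{A} \<turnstile> A \<^bold>\<leftrightarrow> E"
    by (rule iff_trans[OF iff_sym weaken[OF \<theta>(3)]]) simp
  then show ?thesis
    by (intro ImpI) (rule ImpE[OF AndE1 Assm], simp_all)
qed

lemma projective_if_provable:
  assumes "E_projective E A" and "{} \<turnstile> E"
  shows "projective A"
proof -
  have "{} \<turnstile> E \<^bold>\<leftrightarrow> \<^bold>\<top>"
    by (intro AndI ImpI) (simp_all add: Assm weaken[OF assms(2)])
  then show ?thesis
    using assms(1) iff_trans unfolding projective_def E_projective_def fier_def by blast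
qed

theorem theorem3p5:
  fixes A :: "('v, 'p) fm"
  assumes "infinite (UNIV :: 'v set)" and "infinite (UNIV :: 'p set)"
  shows "par_projective A \<and> (\<forall>B. is_U A B \<longrightarrow> projective (B \<^bold>\<rightarrow> A))"
proof (intro conjI allI impI)
  show "par_projective A" by (rule par_projective_all)
next
  fix B assume U: "is_U A B"
  obtain E where E: "E \<in> Lpar" "E_projective E (B \<^bold>\<rightarrow> A)"
    using par_projective_all[of "B \<^bold>\<rightarrow> A"] by (auto simp: par_projective_def)
  note imp = E_projective_imp[OF E(2)]
  have "{} \<turnstile> A \<^bold>\<rightarrow> (B \<^bold>\<rightarrow> A)" by (intro ImpI Assm) simp
  \<comment> \<open>\<open>E\<close> is a parameter formula that follows from \<open>A\<close>
    through \<open>B \<rightarrow> A\<close>, so the minimality of \<open>B\<close> applies to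
    it.\<close>
  then have "{} \<turnstile> B \<^bold>\<rightarrow> E"
    using U E(1) imp_trans[OF _ imp] by (simp add: is_U_def)
  moreover have "{\<^bold>\<not> B} \<turnstile> B \<^bold>\<rightarrow> A"
    by (rule ImpI, rule contradiction[of _ B]; rule Assm) simp_all
  then have "{\<^bold>\<not> B} \<turnstile> E" by (rule ImpE[OF weaken[OF imp], rotated]) simp
  ultimately have "{} \<turnstile> E" by (metis deriv_cases imp_detach)
  with E(2) show "projective (B \<^bold>\<rightarrow> A)" by (rule projective_if_provable)
qed

end
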